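(* Let $k\ge2$ and let $E\subset\mathbb{N}_0$ be a $k$-automatic set. Then either $E$ is $k$-arid or $E$ is an IPS set.
   Context: $E$ is $k$-automatic if its characteristic sequence $a_n=1_{n\in E}$ satisfies $a_n=\tau(\delta(s_0,(n)_k))$ for some finite set $S$, $s_0\in S$, $\delta\colon S\times\{0,\dots,k-1\}\to S$ (extended to words by reading letters left to right), $\tau\colon S\to\{0,1\}$, where $(n)_k$ is the base-$k$ expansion of $n$ without leading zeros. With $\Sigma_k=\{0,\dots,k-1\}$ and $[w]_k$ the integer with base-$k$ expansion $w\in\Sigma_k^*$ (leading zeros allowed): a basic $k$-arid set is $\{v_0w_1^{l_1}v_1\cdots w_r^{l_r}v_r: l_i\in\mathbb{N}_0\}$ with $v_i,w_i\in\Sigma_k^*$, a $k$-arid set of words is a finite union of such, and $E\subset\mathbb{N}_0$ is $k$-arid if $E=\{[u]_k:u\in A\}$ for a $k$-arid set of words $A$. For a sequence $(n_i)_{i\in\mathbb{N}}\subset\mathbb{N}$ and shifts $(N_t)_{t\ge1}\subset\mathbb{N}_0$, the set of shifted finite sums is $\mathrm{FS}(n_i;N_t)=\{\sum_{i\in\alpha}n_i+N_t: t\in\mathbb{N},\ \emptyset\ne\alpha\subset\{1,\dots,t\}\}$; a set is IPS if it contains $\mathrm{FS}(n_i;N_t)$ for some such $(n_i),(N_t)$. *)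

theory Defs
  imports Main "HOL-Library.Indicator_Function"
begin

section \<open>Base-\<open>k\<close> expansions\<close>

text \<open>Words are digit lists, most significant digit first; the expansion of \<open>0\<close> is the empty word.\<close>

function base_expansion :: "nat \<Rightarrow> nat \<Rightarrow> nat list" where
  "base_expansion k n =
     (if k < 2 \<or> n = 0 then [] else base_expansion k (n div k) @ [n mod k])"
  by auto
termination
  by (relation "measure snd") auto

declare base_expansion.simps [simp del]

abbreviation words :: "nat \<Rightarrow> nat list set" where
  "words k \<equiv> lists {..<k}"

definition word_value :: "nat \<Rightarrow> nat list \<Rightarrow> nat" where
  "word_value k w = horner_sum id k (rev w)"

lemma base_expansion_words: "base_expansion k n \<in> words k"
proof (induction k n rule: base_expansion.induct)
  case (1 k n)
  then show ?case
    by (subst base_expansion.simps) auto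
qed

lemma word_value_base_expansion:
  assumes "k \<ge> 2"
  shows "word_value k (base_expansion k n) = n"
  using assms
proof (induction k n rule: base_expansion.induct)
  case (1 k n)
  then show ?case
    by (subst base_expansion.simps) (auto simp: word_value_def)
qed

lemma hd_base_expansion:
  assumes "k \<ge> 2" "n > 0"
  shows "base_expansion k n \<noteq> [] \<and> hd (base_expansion k n) \<noteq> 0"
  using assms
proof (induction k n rule: base_expansion.induct)
  case (1 k n)
  show ?case
  proof (cases "n < k")
    case True
    with "1.prems" show ?thesis
      by (subst (1 2) base_expansion.simps) (simp add: base_expansion.simps[of k 0])
  next
    case False
    with "1.prems" have "n div k > 0"
      by (simp add: div_greater_zero_iff)
    with 1 show ?thesis
      by (subst (1 2) base_expansion.simps) auto
  qed
qed


section \<open>Automatic sets\<close>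

text \<open>Since the state set is finite, taking states in \<^typ>\<open>nat\<close> loses no generality; see
  \<open>automatic_setI\<close> below.\<close>

definition automatic_set :: "nat \<Rightarrow> nat set \<Rightarrow> bool" where
  "automatic_set k E \<longleftrightarrow>
     (\<exists>(S :: nat set) s0 \<delta> (\<tau> :: nat \<Rightarrow> nat).
        finite S \<and> s0 \<in> S \<and> (\<forall>s\<in>S. \<forall>d<k. \<delta> s d \<in> S) \<and> (\<forall>s\<in>S. \<tau> s \<in> {0, 1}) \<and>
        (\<forall>n. indicator E n = \<tau> (foldl \<delta> s0 (base_expansion k n))))"

lemma automatic_setI:
  fixes S :: "'q set" and \<delta> :: "'q \<Rightarrow> nat \<Rightarrow> 'q" and \<tau> :: "'q \<Rightarrow> nat"
  assumes "finite S" "s0 \<in> S"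
    and closed: "\<And>s d. s \<in> S \<Longrightarrow> d < k \<Longrightarrow> \<delta> s d \<in> S"
    and out: "\<And>s. s \<in> S \<Longrightarrow> \<tau> s \<in> {0, 1}"
    and E: "\<And>n. indicator E n = \<tau> (foldl \<delta> s0 (base_expansion k n))"
  shows "automatic_set k E"
proof -
  obtain f :: "'q \<Rightarrow> nat" where f: "inj_on f S"
    using \<open>finite S\<close> finite_imp_inj_to_nat_seg by blast
  define g where "g = inv_into S f"
  have g: "g (f s) = s" if "s \<in> S" for s
    using f that by (simp add: g_def)
  define \<delta>' where "\<delta>' = (\<lambda>a d. f (\<delta> (g a) d))"
  have run: "foldl \<delta> s w \<in> S \<and> foldl \<delta>' (f s) w = f (foldl \<delta> s w)"
    if "s \<in> S" "w \<in> words k" for s w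
    using that
  proof (induction w arbitrary: s)
    case (Cons d w)
    then show ?case using closed[of s d] g by (auto simp: \<delta>'_def)
  qed simp
  show ?thesis
    unfolding automatic_set_def
  proof (intro exI conjI)
    show "finite (f ` S)" "f s0 \<in> f ` S" using assms by auto
    show "\<forall>s\<in>f ` S. \<forall>d<k. \<delta>' s d \<in> f ` S" using closed g by (auto simp: \<delta>'_def)
    show "\<forall>s\<in>f ` S. (\<tau> \<circ> g) s \<in> {0, 1}" using out g by auto
    show "\<forall>n. indicator E n = (\<tau> \<circ> g) (foldl \<delta>' (f s0) (base_expansion k n))"
      using run[OF \<open>s0 \<in> S\<close> base_expansion_words] g E by simp
  qed
qed


section \<open>Arid sets\<close>

definition word_power :: "'a list \<Rightarrow> nat \<Rightarrow> 'a list" where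
  "word_power w l = concat (replicate l w)"

text \<open>The list \<open>ps\<close> holds the pairs \<open>(w\<^sub>1, v\<^sub>1), \<dots>, (w\<^sub>r, v\<^sub>r)\<close> and \<open>ls\<close> the exponents
  \<open>l\<^sub>1, \<dots>, l\<^sub>r\<close>; \<open>r = 0\<close> is allowed.\<close>

definition arid_pattern :: "nat list \<Rightarrow> (nat list \<times> nat list) list \<Rightarrow> nat list set" where
  "arid_pattern v0 ps =
     {v0 @ concat (map2 (\<lambda>(w, v) l. word_power w l @ v) ps ls) | ls. length ls = length ps}"

definition basic_arid_words :: "nat \<Rightarrow> nat list set \<Rightarrow> bool" where
  "basic_arid_words k A \<longleftrightarrow>
     (\<exists>v0 ps. v0 \<in> words k \<and> ps \<in> lists (words k \<times> words k) \<and> A = arid_pattern v0 ps)"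

definition arid_words :: "nat \<Rightarrow> nat list set \<Rightarrow> bool" where
  "arid_words k A \<longleftrightarrow> (\<exists>F. finite F \<and> (\<forall>B\<in>F. basic_arid_words k B) \<and> A = \<Union> F)"

definition arid_set :: "nat \<Rightarrow> nat set \<Rightarrow> bool" where
  "arid_set k E \<longleftrightarrow> (\<exists>A. arid_words k A \<and> E = word_value k ` A)"


section \<open>Shifted finite sums\<close>

text \<open>Sequences are indexed from \<open>1\<close>; their values at \<open>0\<close> are irrelevant.\<close>

definition shifted_FS :: "(nat \<Rightarrow> nat) \<Rightarrow> (nat \<Rightarrow> nat) \<Rightarrow> nat set" where
  "shifted_FS n N = {(\<Sum>i\<in>\<alpha>. n i) + N t | t \<alpha>. t \<ge> 1 \<and> \<alpha> \<noteq> {} \<and> \<alpha> \<subseteq> {1..t}}"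

text \<open>The \<open>n i\<close> must be positive (only the shifts may vanish): otherwise every nonempty set
  would qualify.\<close>

definition IPS_set :: "nat set \<Rightarrow> bool" where
  "IPS_set E \<longleftrightarrow> (\<exists>n N. (\<forall>i\<ge>1. n i \<ge> 1) \<and> shifted_FS n N \<subseteq> E)"

end

theory Submission
  imports Defs
begin

text \<open>Keep only the states that lie on a run accepting the expansion of some positive integer.

  Suppose that at such a state \<open>s\<close> there are two distinct loops \<open>u\<close>, \<open>v\<close> of the same length, and
  say \<open>[u]\<^sub>k < [v]\<^sub>k\<close>. If \<open>p\<close> leads to \<open>s\<close> and \<open>q\<close> from \<open>s\<close> to acceptance, then all words in
  \<open>p {u, v}\<^sup>* q\<close> are accepted; exchanging \<open>u\<close> for \<open>v\<close> in the \<open>i\<close>-th block from the right adds an amount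
  \<open>n\<^sub>i\<close> that does not depend on the other blocks, so the set is IPS with \<open>N\<^sub>t = [p u\<^sup>t q]\<^sub>k\<close>.

  Otherwise the loops at each kept state \<open>s\<close> are the powers of the shortest nonempty one. Splitting
  an accepted word at its last visit to \<open>s\<close> shows, by induction on the set of states
  available to the run, that the accepted words form an arid set.\<close>

section \<open>Values of words\<close>

lemma word_value_simps [simp]:
  "word_value k [] = 0"
  "word_value k (a # w) = a * k ^ length w + word_value k w"
  by (simp_all add: word_value_def horner_sum_append)

lemma word_value_append:
  "word_value k (v @ w) = word_value k v * k ^ length w + word_value k w"
  by (induction v) (simp_all add: algebra_simps power_add)

lemma word_value_less:
  assumes "w \<in> words k"
  shows "word_value k w < k ^ length w"
  using assms
proof (induction w)
  case (Cons a w)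
  then have "Suc a \<le> k" by (simp add: Suc_le_eq)
  have "a * k ^ length w + word_value k w < Suc a * k ^ length w"
    using Cons by simp
  also have "\<dots> \<le> k * k ^ length w"
    using \<open>Suc a \<le> k\<close> by (rule mult_right_mono) simp
  finally show ?case by simp
qed simp

text \<open>The tail is worth less than \<open>k ^ length w\<close>, so division by that power
  recovers the leading digit. This is what orders two distinct loops of equal length
  strictly.\<close>

lemma word_value_inj:
  assumes "v \<in> words k" "w \<in> words k" "length v = length w" "word_value k v = word_value k w"
  shows "v = w"
  using assms(3,1,2,4)
proof (induction v w rule: list_induct2)
  case (Cons a v b w)
  have v: "word_value k v < k ^ length w" and w: "word_value k w < k ^ length w"
    using Cons word_value_less[of v k] word_value_less[of w k] by auto
  have eq: "a * k ^ length w + word_value k v = b * k ^ length w + word_value k w"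
    using Cons by simp
  have nz: "k ^ length w \<noteq> 0" using v by linarith
  have "a = (a * k ^ length w + word_value k v) div k ^ length w"
    unfolding div_mult_self3[OF nz] using v by simp
  also have "\<dots> = b"
    unfolding eq div_mult_self3[OF nz] using w by simp
  finally have "a = b" .
  then show ?case using Cons eq by auto
qed simp

text \<open>\<open>base_expansion\<close> splits off the last digit, hence the induction from the
  right.\<close>

lemma base_expansion_word_value:
  assumes "k \<ge> 2" "w \<in> words k" "w = [] \<or> hd w \<noteq> 0"
  shows "base_expansion k (word_value k w) = w"
  using assms(2,3)
proof (induction w rule: rev_induct)
  case Nil
  then show ?case by (simp add: base_expansion.simps)
next
  case (snoc d w)
  have "w = [] \<or> hd w \<noteq> 0"
    using snoc.prems by (cases w) auto
  then have IH: "base_expansion k (word_value k w) = w"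
    using snoc by simp
  have d: "d < k" using snoc.prems by simp
  have eq: "word_value k (w @ [d]) = word_value k w * k + d"
    by (simp add: word_value_append)
  have "word_value k (w @ [d]) \<noteq> 0"
  proof (cases "w = []")
    case True
    then show ?thesis using snoc.prems by simp
  next
    case False
    \<comment> \<open>Value 0 would make the expansion, which is \<open>w\<close> by
      \<open>IH\<close>, empty.\<close>
    with IH have "word_value k w \<noteq> 0"
      by (metis base_expansion.simps)
    then show ?thesis using assms(1) unfolding eq by simp
  qed
  then show ?case
    using IH d assms(1) unfolding eq by (subst base_expansion.simps) simp
qed

section \<open>Closure properties of arid sets of words\<close>

lemma arid_words_UN:
  assumes "finite I" "\<And>i. i \<in> I \<Longrightarrow> arid_words k (A i)"
  shows "arid_words k (\<Union>i\<in>I. A i)"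
proof -
  have "\<exists>F. \<forall>i\<in>I. finite (F i) \<and> (\<forall>B\<in>F i. basic_arid_words k B) \<and> A i = \<Union>(F i)"
    using assms(2) unfolding arid_words_def by (intro bchoice) auto
  then obtain F where F: "\<forall>i\<in>I. finite (F i) \<and> (\<forall>B\<in>F i. basic_arid_words k B) \<and> A i = \<Union>(F i)" ..
  show ?thesis
    unfolding arid_words_def
    using F assms(1) by (intro exI[of _ "\<Union>i\<in>I. F i"]) auto
qed

lemma arid_words_Un:
  assumes "arid_words k A" "arid_words k B"
  shows "arid_words k (A \<union> B)"
  using arid_words_UN[of UNIV k "\<lambda>b. if b then A else B"] assms
  by (simp add: UNIV_bool Un_commute)

lemma arid_words_empty: "arid_words k {}"
  using arid_words_UN[of "{} :: nat set"] by simp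

text \<open>Recursion on the pairs replaces the list of exponents, so that putting powers in front
  of a pattern amounts to adding one pair.\<close>

lemma arid_pattern_simps:
  "arid_pattern v0 [] = {v0}"
  "arid_pattern v0 ((w, v) # ps) = {v0 @ word_power w l @ x | l x. x \<in> arid_pattern v ps}"
proof -
  show "arid_pattern v0 [] = {v0}" by (auto simp: arid_pattern_def)
  show "arid_pattern v0 ((w, v) # ps) = {v0 @ word_power w l @ x | l x. x \<in> arid_pattern v ps}"
    (is "?L = ?R")
  proof
    show "?L \<subseteq> ?R" by (fastforce simp: arid_pattern_def length_Suc_conv)
    show "?R \<subseteq> ?L"
    proof
      fix y assume "y \<in> ?R"
      then obtain l ls where "length ls = length ps"
        "y = v0 @ word_power w l @ v @ concat (map2 (\<lambda>(w, v) l. word_power w l @ v) ps ls)"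
        by (auto simp: arid_pattern_def)
      then show "y \<in> ?L"
        unfolding arid_pattern_def by (intro CollectI exI[of _ "l # ls"]) simp
    qed
  qed
qed

lemma arid_words_singleton:
  assumes "v \<in> words k"
  shows "arid_words k {v}"
proof -
  have "basic_arid_words k {v}"
    unfolding basic_arid_words_def
    using assms by (intro exI[of _ v] exI[of _ "[]"]) (simp add: arid_pattern_simps)
  then show ?thesis
    unfolding arid_words_def by (intro exI[of _ "{{v}}"]) simp
qed

text \<open>\<open>f\<close> acts on sets of words; since it commutes with unions, it can be studied
  on one pattern at a time.\<close>

lemma arid_words_image:
  assumes "arid_words k A" "\<And>B. basic_arid_words k B \<Longrightarrow> basic_arid_words k (f B)"
    and "\<And>F. f (\<Union>F) = \<Union>(f ` F)"
  shows "arid_words k (f A)"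
proof -
  obtain F where "finite F" "\<forall>B\<in>F. basic_arid_words k B" "A = \<Union>F"
    using assms(1) unfolding arid_words_def by blast
  then show ?thesis
    unfolding arid_words_def using assms(2,3) by (intro exI[of _ "f ` F"]) auto
qed

lemma arid_words_append:
  assumes "u \<in> words k" "arid_words k A"
  shows "arid_words k ((@) u ` A)"
proof (rule arid_words_image[OF assms(2)])
  fix B assume "basic_arid_words k B"
  then obtain v ps where *: "v \<in> words k" "ps \<in> lists (words k \<times> words k)" "B = arid_pattern v ps"
    unfolding basic_arid_words_def by blast
  have "(@) u ` B = arid_pattern (u @ v) ps"
    unfolding * arid_pattern_def by force
  with * assms(1) show "basic_arid_words k ((@) u ` B)"
    unfolding basic_arid_words_def by (metis append_in_lists_conv)
qed auto

lemma arid_words_word_power: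
  assumes "u \<in> words k" "arid_words k A"
  shows "arid_words k {word_power u l @ x | l x. x \<in> A}"
proof (rule arid_words_image[OF assms(2), where f = "\<lambda>A. {word_power u l @ x | l x. x \<in> A}"])
  fix B assume "basic_arid_words k B"
  then obtain v ps where *: "v \<in> words k" "ps \<in> lists (words k \<times> words k)" "B = arid_pattern v ps"
    unfolding basic_arid_words_def by blast
  then have "{word_power u l @ x | l x. x \<in> B} = arid_pattern [] ((u, v) # ps)"
    by (simp add: arid_pattern_simps)
  with * assms(1) show "basic_arid_words k {word_power u l @ x | l x. x \<in> B}"
    unfolding basic_arid_words_def by (intro exI[of _ "[]"] exI[of _ "(u, v) # ps"]) auto
qed blast

section \<open>Runs inside a set of states\<close>

text \<open>All states of the run, both ends included, must lie in \<open>X\<close>; this set is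
  what shrinks in the main induction.\<close>

fun run_in :: "('s \<Rightarrow> nat \<Rightarrow> 's) \<Rightarrow> nat \<Rightarrow> 's set \<Rightarrow> 's \<Rightarrow> nat list \<Rightarrow> 's \<Rightarrow> bool" where
  "run_in \<delta> k X s [] t \<longleftrightarrow> s \<in> X \<and> s = t"
| "run_in \<delta> k X s (a # w) t \<longleftrightarrow> s \<in> X \<and> a < k \<and> run_in \<delta> k X (\<delta> s a) w t"

lemma run_in_foldl: "run_in \<delta> k X s w t \<Longrightarrow> w \<in> words k \<and> foldl \<delta> s w = t"
  by (induction w arbitrary: s) auto

lemma run_in_start: "run_in \<delta> k X s w t \<Longrightarrow> s \<in> X"
  by (cases w) auto

lemma run_in_append:
  "run_in \<delta> k X s (v @ w) t \<longleftrightarrow> run_in \<delta> k X s v (foldl \<delta> s v) \<and> run_in \<delta> k X (foldl \<delta> s v) w t"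
  by (induction v arbitrary: s) (auto dest: run_in_start)

lemma run_in_mono: "run_in \<delta> k X s w t \<Longrightarrow> X \<subseteq> Y \<Longrightarrow> run_in \<delta> k Y s w t"
  by (induction w arbitrary: s) auto

text \<open>The induction cuts the run at its first visit to \<open>r\<close>, if there is
  one.\<close>

lemma run_in_avoid_or_visit:
  assumes "run_in \<delta> k X s w t"
  shows "run_in \<delta> k (X - {r}) s w t \<or> (\<exists>u v. w = u @ v \<and> run_in \<delta> k X s u r \<and> run_in \<delta> k X r v t)"
  using assms
proof (induction w arbitrary: s)
  case (Cons a w)
  show ?case
  proof (cases "s = r")
    case True
    with Cons.prems show ?thesis by (intro disjI2 exI[of _ "[]"] exI[of _ "a # w"]) auto
  next
    case False
    from Cons have "run_in \<delta> k (X - {r}) (\<delta> s a) w t \<or>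
        (\<exists>u v. w = u @ v \<and> run_in \<delta> k X (\<delta> s a) u r \<and> run_in \<delta> k X r v t)" by simp
    then show ?thesis
    proof
      assume "\<exists>u v. w = u @ v \<and> run_in \<delta> k X (\<delta> s a) u r \<and> run_in \<delta> k X r v t"
      then obtain u v where "w = u @ v" "run_in \<delta> k X (\<delta> s a) u r" "run_in \<delta> k X r v t" by blast
      with Cons.prems show ?thesis by (intro disjI2 exI[of _ "a # u"] exI[of _ v]) auto
    qed (use False Cons.prems in auto)
  qed
qed auto

lemma run_in_word_power:
  assumes "run_in \<delta> k X s w s"
  shows "run_in \<delta> k X s (word_power w l) s"
proof (induction l)
  case 0
  show ?case using run_in_start[OF assms] by (simp add: word_power_def)
next
  case (Suc l)
  then show ?case
    using assms run_in_foldl[OF assms] by (simp add: word_power_def run_in_append)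
qed

text \<open>The loops are not confined to a set of states, so the property is unaffected when the
  set available to runs shrinks.\<close>

definition unique_loops :: "('s \<Rightarrow> nat \<Rightarrow> 's) \<Rightarrow> nat \<Rightarrow> 's \<Rightarrow> bool" where
  "unique_loops \<delta> k s \<longleftrightarrow>
     (\<forall>u\<in>words k. \<forall>v\<in>words k. foldl \<delta> s u = s \<longrightarrow> foldl \<delta> s v = s \<longrightarrow> length u = length v \<longrightarrow> u = v)"

text \<open>Take a shortest nonempty loop \<open>x\<close>, or the empty word if there is none. It
  is a prefix of every nonempty loop, and stripping it off leaves a shorter loop.\<close>

lemma loops_powers:
  assumes "s \<in> X" "unique_loops \<delta> k s"
  obtains x where "run_in \<delta> k X s x s" "\<And>c. run_in \<delta> k X s c s \<Longrightarrow> \<exists>l. c = word_power x l"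
proof (cases "\<exists>c. c \<noteq> [] \<and> run_in \<delta> k X s c s")
  case False
  have "run_in \<delta> k X s [] s" using assms(1) by simp
  moreover have "\<exists>l. c = word_power [] l" if "run_in \<delta> k X s c s" for c
    using that False by (auto simp: word_power_def)
  ultimately show ?thesis using that by blast
next
  case True
  then have "\<exists>x. (x \<noteq> [] \<and> run_in \<delta> k X s x s) \<and>
      (\<forall>c. c \<noteq> [] \<and> run_in \<delta> k X s c s \<longrightarrow> length x \<le> length c)"
    by (elim exE) (rule ex_has_least_nat)
  then obtain x where x: "x \<noteq> []" "run_in \<delta> k X s x s"
    and least: "\<And>c. c \<noteq> [] \<Longrightarrow> run_in \<delta> k X s c s \<Longrightarrow> length x \<le> length c"
    by auto
  have "\<exists>l. c = word_power x l" if "run_in \<delta> k X s c s" for c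
    using that
  proof (induction c rule: length_induct)
    case (1 c)
    show ?case
    proof (cases "c = []")
      case True
      then show ?thesis by (intro exI[of _ 0]) (simp add: word_power_def)
    next
      case False
      \<comment> \<open>both are loops at \<open>s\<close> of the same length, so \<open>x\<close> is a prefix of \<open>c\<close>\<close>
      have "x @ c = c @ x"
        using assms(2) run_in_foldl[OF x(2)] run_in_foldl[OF "1.prems"]
        unfolding unique_loops_def by auto
      then have "take (length x) (x @ c) = take (length x) (c @ x)" by simp
      then have "x = take (length x) c"
        using least[OF False "1.prems"] by simp
      then obtain c' where c': "c = x @ c'" by (metis append_take_drop_id)
      then have "run_in \<delta> k X s c' s"
        using "1.prems" run_in_foldl[OF x(2)] by (simp add: run_in_append)
      moreover have "length c' < length c" using c' x(1) by simp
      ultimately obtain l where "c' = word_power x l"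
        using "1.IH" by blast
      then have "c = word_power x (Suc l)"
        using c' by (simp add: word_power_def)
      then show ?thesis ..
    qed
  qed
  with x(2) show ?thesis using that by blast
qed

lemma arid_words_run_in:
  assumes "finite X" "\<And>s. s \<in> X \<Longrightarrow> unique_loops \<delta> k s"
  shows "arid_words k {w. run_in \<delta> k X s w t}"
  using assms
proof (induction X arbitrary: s rule: finite_psubset_induct)
  case (psubset X s)
  show ?case
  proof (cases "s \<in> X")
    case False
    then have "{w. run_in \<delta> k X s w t} = {}" using run_in_start by fast
    then show ?thesis by (simp add: arid_words_empty)
  next
    case True
    obtain x where x: "run_in \<delta> k X s x s"
      and powers: "\<And>c. run_in \<delta> k X s c s \<Longrightarrow> \<exists>l. c = word_power x l"
      using loops_powers[OF True psubset.prems[OF True]] by blast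
    \<comment> \<open>What can be read after the last visit to \<open>s\<close>: nothing, or a
      letter followed by a run that avoids \<open>s\<close>.\<close>
    define R where "R = (if s = t then {[]} else {}) \<union>
      (\<Union>a\<in>{..<k}. (@) [a] ` {w. run_in \<delta> k (X - {s}) (\<delta> s a) w t})"
    have "arid_words k {w. run_in \<delta> k (X - {s}) r w t}" for r
      using True by (intro psubset.IH psubset.prems) auto
    then have "arid_words k R"
      unfolding R_def
      by (intro arid_words_Un arid_words_UN arid_words_append)
         (auto intro: arid_words_empty arid_words_singleton)
    moreover have "{w. run_in \<delta> k X s w t} = {word_power x l @ w | l w. w \<in> R}"
    proof (intro equalityI subsetI)
      fix w assume "w \<in> {word_power x l @ w | l w. w \<in> R}"
      then obtain l w' where w: "w = word_power x l @ w'" "w' \<in> R" by blast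
      have "run_in \<delta> k X s w' t"
        using w(2) True by (auto simp: R_def split: if_splits intro: run_in_mono)
      then show "w \<in> {w. run_in \<delta> k X s w t}"
        using run_in_word_power[OF x, of l] run_in_foldl[OF run_in_word_power[OF x, of l]]
        by (simp add: w run_in_append)
    next
      fix w assume "w \<in> {w. run_in \<delta> k X s w t}"
      then have "run_in \<delta> k X s w t" by simp
      then show "w \<in> {word_power x l @ w | l w. w \<in> R}"
      proof (induction w rule: length_induct)
        case (1 w)
        have power0: "w \<in> {word_power x l @ w | l w. w \<in> R}" if "w \<in> R"
          using that by (intro CollectI exI[of _ 0] exI[of _ w]) (simp add: word_power_def)
        show ?case
        proof (cases w)
          case Nil
          with "1.prems" show ?thesis by (intro power0) (auto simp: R_def)
        next
          case (Cons a w1)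
          with "1.prems" have a: "a < k" and run: "run_in \<delta> k X (\<delta> s a) w1 t" by auto
          \<comment> \<open>Without a return to \<open>s\<close> the word is in \<open>R\<close>.
            Otherwise the part up to the return is a loop, hence a power of \<open>x\<close>, and
            the shorter rest is covered by the induction on length.\<close>
          from run_in_avoid_or_visit[OF run, of s] show ?thesis
          proof
            assume "run_in \<delta> k (X - {s}) (\<delta> s a) w1 t"
            with a Cons show ?thesis by (intro power0) (auto simp: R_def)
          next
            assume "\<exists>u v. w1 = u @ v \<and> run_in \<delta> k X (\<delta> s a) u s \<and> run_in \<delta> k X s v t"
            then obtain u v where uv: "w1 = u @ v" "run_in \<delta> k X (\<delta> s a) u s" "run_in \<delta> k X s v t"
              by blast
            obtain m where m: "a # u = word_power x m"
              using powers[of "a # u"] uv(2) a True by auto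
            obtain l w' where v: "v = word_power x l @ w'" "w' \<in> R"
              using "1.IH" uv Cons by force
            have "w = word_power x (m + l) @ w'"
              using Cons uv(1) v(1) m by (simp add: word_power_def replicate_add flip: append_Cons)
            then show ?thesis using v(2) by blast
          qed
        qed
      qed
    qed
    ultimately show ?thesis
      using arid_words_word_power[of x k R] run_in_foldl[OF x] by simp
  qed
qed

section \<open>Two loops of the same length\<close>

text \<open>Blocks are numbered from the right, so that block \<open>i\<close> has weight \<open>k\<^bsup>(i - 1) |u|\<^esup>\<close>.\<close>

primrec blocks :: "'a list \<Rightarrow> 'a list \<Rightarrow> nat set \<Rightarrow> nat \<Rightarrow> 'a list" where
  "blocks u v \<alpha> 0 = []"
| "blocks u v \<alpha> (Suc t) = (if Suc t \<in> \<alpha> then v else u) @ blocks u v \<alpha> t"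

lemma length_blocks: "length u = length v \<Longrightarrow> length (blocks u v \<alpha> t) = t * length u"
  by (induction t) auto

lemma blocks_words: "u \<in> lists A \<Longrightarrow> v \<in> lists A \<Longrightarrow> blocks u v \<alpha> t \<in> lists A"
  by (induction t) auto

lemma foldl_blocks: "foldl \<delta> s u = s \<Longrightarrow> foldl \<delta> s v = s \<Longrightarrow> foldl \<delta> s (blocks u v \<alpha> t) = s"
  by (induction t) auto

lemma word_value_blocks:
  assumes "length u = length v" "word_value k u \<le> word_value k v"
  shows "word_value k (blocks u v \<alpha> t) = word_value k (blocks u v {} t) +
    (\<Sum>i\<in>\<alpha> \<inter> {1..t}. (word_value k v - word_value k u) * k ^ ((i - 1) * length u))"
proof (induction t)
  case (Suc t)
  have len: "length (blocks u v \<beta> t) = t * length u" for \<beta>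
    using length_blocks[OF assms(1)] .
  have *: "\<alpha> \<inter> {Suc 0..Suc t} =
      (if Suc t \<in> \<alpha> then insert (Suc t) (\<alpha> \<inter> {Suc 0..t}) else \<alpha> \<inter> {Suc 0..t})"
    by (auto simp: le_Suc_eq)
  \<comment> \<open>The assumed inequality keeps the subtraction of naturals from being
    truncated.\<close>
  have v: "word_value k v = (word_value k v - word_value k u) + word_value k u"
    using assms(2) by simp
  show ?case
  proof (cases "Suc t \<in> \<alpha>")
    case True
    have "word_value k (blocks u v \<alpha> (Suc t)) =
        word_value k v * k ^ (t * length u) + word_value k (blocks u v \<alpha> t)"
      using True by (simp add: word_value_append len)
    also have "word_value k v * k ^ (t * length u) =
        (word_value k v - word_value k u) * k ^ (t * length u) + word_value k u * k ^ (t * length u)"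
      by (subst v) (simp only: distrib_right)
    finally show ?thesis
      using True Suc by (simp add: * word_value_append len)
  next
    case False
    then show ?thesis using Suc by (simp add: * word_value_append len)
  qed
qed simp

text \<open>The nonzero first digit of \<open>p\<close> makes every pumped word a genuine expansion,
  and all of them end in the same state as the word \<open>p @ q\<close>.\<close>

lemma IPS_set_of_two_loops:
  assumes "k \<ge> 2"
    and p: "p \<in> words k" "p \<noteq> []" "hd p \<noteq> 0" "foldl \<delta> s0 p = s" and q: "q \<in> words k"
    and E: "\<And>w. w \<in> words k \<Longrightarrow> w \<noteq> [] \<Longrightarrow> hd w \<noteq> 0 \<Longrightarrow>
      foldl \<delta> s0 w = foldl \<delta> s q \<Longrightarrow> word_value k w \<in> E"
    and loops: "\<not> unique_loops \<delta> k s"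
  shows "IPS_set E"
proof -
  obtain u' v' where uv': "u' \<in> words k" "v' \<in> words k" "foldl \<delta> s u' = s" "foldl \<delta> s v' = s"
    "length u' = length v'" "u' \<noteq> v'"
    using loops unfolding unique_loops_def by blast
  then have "word_value k u' \<noteq> word_value k v'"
    using word_value_inj by blast
  then obtain u v where uv: "u \<in> words k" "v \<in> words k" "foldl \<delta> s u = s" "foldl \<delta> s v = s"
    "length u = length v" "word_value k u < word_value k v"
    using uv' by (metis nat_neq_iff)
  \<comment> \<open>The last factor shifts the blocks past \<open>q\<close>. Strictness of
    \<open>uv(6)\<close> makes every \<open>n i\<close> positive, even at 0, where
    \<open>i - 1\<close> is truncated to 0.\<close>
  define n where "n i = (word_value k v - word_value k u) * k ^ ((i - 1) * length u) * k ^ length q" for i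
  define N where "N t = word_value k (p @ blocks u v {} t @ q)" for t
  have "(\<Sum>i\<in>\<alpha>. n i) + N t \<in> E" if "\<alpha> \<subseteq> {1..t}" for \<alpha> t
  proof -
    have "\<alpha> \<inter> {1..t} = \<alpha>" using that by blast
    then have "(\<Sum>i\<in>\<alpha>. n i) + N t = word_value k (p @ blocks u v \<alpha> t @ q)"
      using word_value_blocks[of u v k \<alpha> t] uv(5,6)
      by (simp add: n_def N_def word_value_append length_blocks distrib_right sum_distrib_right)
    also have "\<dots> \<in> E"
    proof (rule E)
      show "p @ blocks u v \<alpha> t @ q \<in> words k"
        using p q blocks_words[OF uv(1,2)] by simp
    qed (use p in \<open>simp_all add: foldl_blocks[OF uv(3,4)]\<close>)
    finally show ?thesis .
  qed
  then have "shifted_FS n N \<subseteq> E" unfolding shifted_FS_def by auto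
  moreover have "\<forall>i. n i \<ge> 1"
    using uv(6) assms(1) by (simp add: n_def Suc_le_eq)
  ultimately show ?thesis unfolding IPS_set_def by blast
qed

section \<open>The dichotomy\<close>

theorem theorem3p10:
  fixes k :: nat and E :: "nat set"
  assumes "k \<ge> 2" and "automatic_set k E"
  shows "arid_set k E \<or> IPS_set E"
proof -
  obtain S :: "nat set" and s0 \<delta> and \<tau> :: "nat \<Rightarrow> nat" where
    S: "finite S" "s0 \<in> S" "\<forall>s\<in>S. \<forall>d<k. \<delta> s d \<in> S"
    and \<tau>: "\<And>n. indicator E n = \<tau> (foldl \<delta> s0 (base_expansion k n))"
    using assms(2) unfolding automatic_set_def by blast
  have closed: "foldl \<delta> s w \<in> S" if "s \<in> S" "w \<in> words k" for s w
    using that S(3) by (induction w arbitrary: s) auto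
  have E: "n \<in> E \<longleftrightarrow> \<tau> (foldl \<delta> s0 (base_expansion k n)) = 1" for n
    using \<tau>[of n] by (cases "n \<in> E") auto
  have word_E: "word_value k w \<in> E \<longleftrightarrow> \<tau> (foldl \<delta> s0 w) = 1"
    if "w \<in> words k" "w = [] \<or> hd w \<noteq> 0" for w
    using E base_expansion_word_value[OF assms(1) that] by simp
  define X where "X = {s. \<exists>p q. p \<in> words k \<and> p \<noteq> [] \<and> hd p \<noteq> 0 \<and> q \<in> words k \<and>
    foldl \<delta> s0 p = s \<and> \<tau> (foldl \<delta> s q) = 1}"
  show ?thesis
  proof (cases "\<forall>s\<in>X. unique_loops \<delta> k s")
    case False
    then obtain s p q where *: "p \<in> words k" "p \<noteq> []" "hd p \<noteq> 0" "q \<in> words k"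
      "foldl \<delta> s0 p = s" "\<tau> (foldl \<delta> s q) = 1" "\<not> unique_loops \<delta> k s"
      unfolding X_def by blast
    have "IPS_set E"
      by (rule IPS_set_of_two_loops[OF assms(1) *(1,2,3,5,4) _ *(7)]) (simp add: word_E *(6))
    then show ?thesis ..
  next
    case True
    have "X \<subseteq> S" unfolding X_def using S(2) closed by auto
    then have "finite X" using S(1) finite_subset by blast
    \<comment> \<open>Each induction step moves a letter from \<open>w\<close> to \<open>p\<close>;
      the current \<open>p\<close> and the remaining \<open>w\<close> witness that the state reached
      is in \<open>X\<close>.\<close>
    have run: "run_in \<delta> k X (foldl \<delta> s0 p) w (foldl \<delta> s0 (p @ w))"
      if "p \<in> words k" "p \<noteq> []" "hd p \<noteq> 0" "w \<in> words k" "\<tau> (foldl \<delta> s0 (p @ w)) = 1" for p w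
      using that
    proof (induction w arbitrary: p)
      case Nil
      then have "foldl \<delta> s0 p \<in> X"
        unfolding X_def by (intro CollectI exI[of _ p] exI[of _ "[]"]) auto
      then show ?case by simp
    next
      case (Cons a w)
      have "foldl \<delta> s0 p \<in> X"
        using Cons.prems unfolding X_def by (intro CollectI exI[of _ p] exI[of _ "a # w"]) auto
      moreover have "run_in \<delta> k X (foldl \<delta> s0 (p @ [a])) w (foldl \<delta> s0 ((p @ [a]) @ w))"
        using Cons.prems by (intro Cons.IH) auto
      ultimately show ?case using Cons.prems by simp
    qed
    \<comment> \<open>\<open>s0\<close> may lie outside \<open>X\<close>, so the nonzero first digit
      is read before the run in \<open>X\<close> starts. The number 0 enters as the empty
      word.\<close>
    define A where "A = (if 0 \<in> E then {[]} else {}) \<union>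
      (\<Union>a\<in>{1..<k}. \<Union>t\<in>{t\<in>S. \<tau> t = 1}. (@) [a] ` {w. run_in \<delta> k X (\<delta> s0 a) w t})"
    have "arid_words k A"
      unfolding A_def using \<open>finite X\<close> True S(1)
      by (intro arid_words_Un arid_words_UN arid_words_append arid_words_run_in)
         (auto intro: arid_words_empty arid_words_singleton)
    moreover have "E = word_value k ` A"
    proof (intro equalityI subsetI)
      fix n assume n: "n \<in> E"
      let ?w = "base_expansion k n"
      have "?w \<in> A"
      proof (cases "n = 0")
        case True
        with n show ?thesis by (simp add: A_def base_expansion.simps)
      next
        case False
        then obtain a w where w: "?w = a # w" "a \<noteq> 0"
          using hd_base_expansion[OF assms(1), of n] by (cases ?w) auto
        then have aw: "a < k" "w \<in> words k"
          using base_expansion_words[of k n] by auto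
        have "\<tau> (foldl \<delta> s0 ([a] @ w)) = 1"
          using n E[of n] w by simp
        then have "run_in \<delta> k X (\<delta> s0 a) w (foldl \<delta> s0 (a # w))"
          using run[of "[a]" w] aw w(2) by simp
        moreover have "foldl \<delta> s0 (a # w) \<in> {t\<in>S. \<tau> t = 1}"
          using n E[of n] w closed[OF S(2) base_expansion_words[of k n]] by simp
        ultimately show ?thesis
          using aw w unfolding A_def by force
      qed
      then show "n \<in> word_value k ` A"
        using word_value_base_expansion[OF assms(1), of n] by force
    next
      fix n assume "n \<in> word_value k ` A"
      then obtain w where w: "w \<in> A" "n = word_value k w" by blast
      \<comment> \<open>Words of \<open>A\<close> have no leading zero, so \<open>word_E\<close>
        decides membership of their values.\<close>
      then consider "0 \<in> E" "w = []" | a w' t where "a \<in> {1..<k}" "\<tau> t = 1" "w = a # w'"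
        "run_in \<delta> k X (\<delta> s0 a) w' t"
        unfolding A_def by (auto split: if_splits)
      then show "n \<in> E"
      proof cases
        case 1
        then show ?thesis using w by simp
      next
        case 2
        then show ?thesis
          using word_E[of w] w(2) run_in_foldl[OF 2(4)] by auto
      qed
    qed
    ultimately show ?thesis unfolding arid_set_def by blast
  qed
qed

end
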